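(* Let $A$ be a finite abelian group with Pontryagin dual $\hat A$, and let $\mu,\nu$ be probability measures on $A$ and $\hat A$ respectively. Let $(\mathcal{M},\tau)$ be a von Neumann algebra with a normal faithful tracial state and $U:A\to\mathcal{U}(\mathcal{M})$, $V:\hat A\to\mathcal{U}(\mathcal{M})$ group homomorphisms satisfying \[\int\|U(a)V(\chi)-\chi(a)V(\chi)U(a)\|_2^2\,d\mu(a)\,d\nu(\chi)\leq\varepsilon.\] Then \[\mathbf{E}_{a\in A,\chi\in\hat A}\|U(a)V(\chi)-\chi(a)V(\chi)U(a)\|_2^2\leq\kappa(\mu)\kappa(\nu)\varepsilon.\]
   Context: $\hat A$ is the group of characters (homomorphisms $A\to\{z\in\mathbf{C}:|z|=1\}$). $\|x\|_2=\tau(x^*x)^{1/2}$, $\mathbf{E}$ is the uniform average. For a probability measure $\mu$ on a finite group $G$, $\kappa(\mu)\in[0,+\infty]$ is the smallest constant $\kappa$ such that for every unitary representation $(\pi,\mathcal{H})$ of $G$ and every $\xi$, $\|\xi-P_{\mathcal{H}^\pi}\xi\|^2\leq\frac\kappa2\int\|\pi(g)\xi-\xi\|^2d\mu(g)$, with $P_{\mathcal{H}^\pi}$ the projection onto invariant vectors (if some $\kappa$ is infinite the right side is $+\infty$). *)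

theory Defs
  imports "HOL-Algebra.Algebra" "HOL-Library.Extended_Real"
begin

section \<open>Probability measures on finite sets\<close>

definition prob_on :: "'x set \<Rightarrow> ('x \<Rightarrow> real) \<Rightarrow> bool" where
  "prob_on S p \<longleftrightarrow> (\<forall>x\<in>S. 0 \<le> p x) \<and> sum p S = 1"

section \<open>Pontryagin dual of a finite abelian group\<close>

definition characters :: "('a, 'b) monoid_scheme \<Rightarrow> ('a \<Rightarrow> complex) set" where
  "characters A = {\<chi> \<in> carrier A \<rightarrow>\<^sub>E {z. cmod z = 1}.
      \<forall>x\<in>carrier A. \<forall>y\<in>carrier A. \<chi> (x \<otimes>\<^bsub>A\<^esub> y) = \<chi> x * \<chi> y}"

definition dual_group :: "('a, 'b) monoid_scheme \<Rightarrow> ('a \<Rightarrow> complex) monoid" where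
  "dual_group A = \<lparr>carrier = characters A,
      monoid.mult = (\<lambda>\<chi> \<psi>. \<lambda>a\<in>carrier A. \<chi> a * \<psi> a),
      monoid.one = (\<lambda>a\<in>carrier A. 1)\<rparr>"

section \<open>Unitary representations on finite-dimensional Hilbert spaces C^n and kappa\<close>

text \<open>Vectors of C^n are functions nat => complex vanishing outside {..<n}.\<close>

definition vsp :: "nat \<Rightarrow> (nat \<Rightarrow> complex) set" where
  "vsp n = {\<xi>. \<forall>i\<ge>n. \<xi> i = 0}"

definition cinner :: "nat \<Rightarrow> (nat \<Rightarrow> complex) \<Rightarrow> (nat \<Rightarrow> complex) \<Rightarrow> complex" where
  "cinner n \<xi> \<eta> = (\<Sum>i<n. cnj (\<xi> i) * \<eta> i)"

definition vnorm2 :: "nat \<Rightarrow> (nat \<Rightarrow> complex) \<Rightarrow> real" where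
  "vnorm2 n \<xi> = (\<Sum>i<n. (cmod (\<xi> i))\<^sup>2)"

definition unitary_rep ::
  "('g, 'b) monoid_scheme \<Rightarrow> nat \<Rightarrow> ('g \<Rightarrow> (nat \<Rightarrow> complex) \<Rightarrow> (nat \<Rightarrow> complex)) \<Rightarrow> bool" where
  "unitary_rep G n \<pi> \<longleftrightarrow>
     (\<forall>g\<in>carrier G.
        bij_betw (\<pi> g) (vsp n) (vsp n) \<and>
        (\<forall>\<xi>\<in>vsp n. \<forall>\<eta>\<in>vsp n. \<forall>c d.
            \<pi> g (\<lambda>i. c * \<xi> i + d * \<eta> i) = (\<lambda>i. c * \<pi> g \<xi> i + d * \<pi> g \<eta> i)) \<and>
        (\<forall>\<xi>\<in>vsp n. \<forall>\<eta>\<in>vsp n. cinner n (\<pi> g \<xi>) (\<pi> g \<eta>) = cinner n \<xi> \<eta>)) \<and>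
     (\<forall>g\<in>carrier G. \<forall>h\<in>carrier G. \<forall>\<xi>\<in>vsp n. \<pi> (g \<otimes>\<^bsub>G\<^esub> h) \<xi> = \<pi> g (\<pi> h \<xi>))"

definition invariants ::
  "('g, 'b) monoid_scheme \<Rightarrow> nat \<Rightarrow> ('g \<Rightarrow> (nat \<Rightarrow> complex) \<Rightarrow> (nat \<Rightarrow> complex)) \<Rightarrow> (nat \<Rightarrow> complex) set" where
  "invariants G n \<pi> = {\<eta> \<in> vsp n. \<forall>g\<in>carrier G. \<pi> g \<eta> = \<eta>}"

text \<open>Orthogonal projection onto the invariant vectors.\<close>
definition inv_proj ::
  "('g, 'b) monoid_scheme \<Rightarrow> nat \<Rightarrow> ('g \<Rightarrow> (nat \<Rightarrow> complex) \<Rightarrow> (nat \<Rightarrow> complex)) \<Rightarrow> (nat \<Rightarrow> complex) \<Rightarrow> (nat \<Rightarrow> complex)" where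
  "inv_proj G n \<pi> \<xi> = (THE \<eta>. \<eta> \<in> invariants G n \<pi> \<and>
       (\<forall>\<zeta>\<in>invariants G n \<pi>. cinner n \<zeta> (\<xi> - \<eta>) = 0))"

definition kappa_const :: "('g, 'b) monoid_scheme \<Rightarrow> ('g \<Rightarrow> real) \<Rightarrow> real \<Rightarrow> bool" where
  "kappa_const G \<mu> k \<longleftrightarrow> (\<forall>n \<pi> \<xi>. unitary_rep G n \<pi> \<longrightarrow> \<xi> \<in> vsp n \<longrightarrow>
      vnorm2 n (\<xi> - inv_proj G n \<pi> \<xi>)
        \<le> k / 2 * (\<Sum>g\<in>carrier G. \<mu> g * vnorm2 n (\<pi> g \<xi> - \<xi>)))"

text \<open>kappa(mu) in [0, +infinity]: the smallest admissible constant (infimum; +infinity if none).\<close>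
definition kappa :: "('g, 'b) monoid_scheme \<Rightarrow> ('g \<Rightarrow> real) \<Rightarrow> ereal" where
  "kappa G \<mu> = Inf {ereal k | k. 0 \<le> k \<and> kappa_const G \<mu> k}"

section \<open>Unital *-algebras with a faithful tracial state\<close>

definition tracial_star_algebra ::
  "(complex \<Rightarrow> 'm::ring_1 \<Rightarrow> 'm) \<Rightarrow> ('m \<Rightarrow> 'm) \<Rightarrow> ('m \<Rightarrow> complex) \<Rightarrow> bool" where
  "tracial_star_algebra sm st tau \<longleftrightarrow>
     (\<forall>x. sm 1 x = x) \<and> (\<forall>a b x. sm a (sm b x) = sm (a * b) x) \<and>
     (\<forall>a b x. sm (a + b) x = sm a x + sm b x) \<and> (\<forall>a x y. sm a (x + y) = sm a x + sm a y) \<and>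
     (\<forall>a x y. sm a (x * y) = sm a x * y \<and> sm a (x * y) = x * sm a y) \<and>
     (\<forall>x. st (st x) = x) \<and> (\<forall>x y. st (x + y) = st x + st y) \<and>
     (\<forall>a x. st (sm a x) = sm (cnj a) (st x)) \<and> (\<forall>x y. st (x * y) = st y * st x) \<and>
     (\<forall>x y. tau (x + y) = tau x + tau y) \<and> (\<forall>a x. tau (sm a x) = a * tau x) \<and>
     (\<forall>x y. tau (x * y) = tau (y * x)) \<and> tau 1 = 1 \<and>
     (\<forall>x. Im (tau (st x * x)) = 0 \<and> 0 \<le> Re (tau (st x * x))) \<and>
     (\<forall>x. tau (st x * x) = 0 \<longrightarrow> x = 0)"

definition unitaries :: "('m::ring_1 \<Rightarrow> 'm) \<Rightarrow> 'm set" where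
  "unitaries st = {u. st u * u = 1 \<and> u * st u = 1}"

text \<open>Squared 2-norm: norm2sq x = tau(x^* x) = ||x||_2^2.\<close>
definition norm2sq :: "('m::ring_1 \<Rightarrow> 'm) \<Rightarrow> ('m \<Rightarrow> complex) \<Rightarrow> 'm \<Rightarrow> real" where
  "norm2sq st tau x = Re (tau (st x * x))"

end

theory Submission
  imports Defs
begin

(*
  For a unitary representation pi of a finite group G, the average of |pi(g) xi - xi|^2 over G
  equals 2 |xi - P xi|^2, P being the average of pi over G, i.e. the projection onto the invariant
  vectors. So the definition of kappa(mu) bounds the uniform average of the displacements by
  kappa(mu) times their mu-average. Since kappa only refers to representations on C^n, this is
  transferred to a unitary action on any complex inner product space: the orbit of a vector spans
  a finite-dimensional invariant subspace, and Gram-Schmidt coordinates turn the action there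
  into a representation on C^d.

  With the inner product tau(x^* y) on M, fix chi: then y |-> conj(chi a) U(a) y U(a)^* is a
  unitary action of A, and the displacement of V(chi) under a has norm
  |U(a) V(chi) - chi(a) V(chi) U(a)|_2. Symmetrically, fix a: as the dual group is abelian,
  y |-> conj(chi a) V(chi)^* y V(chi) is a unitary action of the dual group, with displacement of
  U(a) of the same norm. Averaging first over a and then over chi gives the factor
  kappa(mu) kappa(nu).
*)

section \<open>The constant kappa\<close>

lemma vnorm2_nonneg: "0 \<le> vnorm2 n \<xi>"
  by (simp add: vnorm2_def sum_nonneg)

lemma kappa_const_Inf:
  assumes "K \<noteq> {}" and "\<forall>k\<in>K. kappa_const G \<mu> k" and "\<forall>g\<in>carrier G. 0 \<le> \<mu> g"
  shows "kappa_const G \<mu> (Inf K)"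
  unfolding kappa_const_def
proof (intro allI impI)
  fix n \<pi> \<xi> assume "unitary_rep G n \<pi>" and "\<xi> \<in> vsp n"
  define L where "L = vnorm2 n (\<xi> - inv_proj G n \<pi> \<xi>)"
  define S where "S = (\<Sum>g\<in>carrier G. \<mu> g * vnorm2 n (\<pi> g \<xi> - \<xi>))"
  have L_le: "L \<le> k / 2 * S" if "k \<in> K" for k
    using assms(2) that \<open>unitary_rep G n \<pi>\<close> \<open>\<xi> \<in> vsp n\<close>
    unfolding kappa_const_def L_def S_def by blast
  have "0 \<le> S"
    unfolding S_def using assms(3)
    by (intro sum_nonneg mult_nonneg_nonneg) (auto simp: vnorm2_nonneg)
  show "L \<le> Inf K / 2 * S"
  proof (cases "S = 0")
    case True
    with L_le \<open>K \<noteq> {}\<close> show ?thesis by auto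
  next
    case False
    with \<open>0 \<le> S\<close> have "0 < S" by simp
    have "2 * L / S \<le> Inf K"
      using L_le \<open>K \<noteq> {}\<close> \<open>0 < S\<close> by (intro cInf_greatest) (auto simp: field_simps)
    with \<open>0 < S\<close> show ?thesis by (simp add: field_simps)
  qed
qed

lemma kappa_finite_admissible:
  assumes "kappa G \<mu> \<noteq> \<infinity>" and "\<forall>g\<in>carrier G. 0 \<le> \<mu> g"
  shows "kappa_const G \<mu> (real_of_ereal (kappa G \<mu>))" and "0 \<le> real_of_ereal (kappa G \<mu>)"
proof -
  define K where "K = {k. 0 \<le> k \<and> kappa_const G \<mu> k}"
  have kappa_K: "kappa G \<mu> = (INF k\<in>K. ereal k)"
    unfolding kappa_def K_def by (simp add: setcompr_eq_image)
  with assms(1) have "K \<noteq> {}" by (auto simp: top_ereal_def)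
  moreover have "bdd_below K" unfolding K_def by (rule bdd_belowI[of _ 0]) simp
  ultimately have "real_of_ereal (kappa G \<mu>) = Inf K"
    by (simp add: kappa_K flip: ereal_Inf')
  moreover have "kappa_const G \<mu> (Inf K)"
    using \<open>K \<noteq> {}\<close> assms(2) by (intro kappa_const_Inf) (auto simp: K_def)
  moreover have "0 \<le> Inf K"
    using \<open>K \<noteq> {}\<close> by (intro cInf_greatest) (auto simp: K_def)
  ultimately show "kappa_const G \<mu> (real_of_ereal (kappa G \<mu>))"
    and "0 \<le> real_of_ereal (kappa G \<mu>)"
    by simp_all
qed

lemma double_average_le:
  fixes f :: "'x \<Rightarrow> 'y \<Rightarrow> real"
  assumes "\<forall>x\<in>I. 0 \<le> \<mu> x" and "0 \<le> k"
    and avg_I: "\<And>y. y \<in> J \<Longrightarrow> (\<Sum>x\<in>I. f x y) / card I \<le> k * (\<Sum>x\<in>I. \<mu> x * f x y)"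
    and avg_J: "\<And>x. x \<in> I \<Longrightarrow> (\<Sum>y\<in>J. f x y) / card J \<le> k' * (\<Sum>y\<in>J. \<nu> y * f x y)"
  shows "(\<Sum>x\<in>I. \<Sum>y\<in>J. f x y) / real (card I * card J)
           \<le> k * k' * (\<Sum>x\<in>I. \<Sum>y\<in>J. \<mu> x * \<nu> y * f x y)"
proof -
  have "(\<Sum>x\<in>I. \<Sum>y\<in>J. f x y) / real (card I * card J)
      = (\<Sum>y\<in>J. (\<Sum>x\<in>I. f x y) / card I) / card J"
    by (simp add: sum.swap[of _ I] sum_divide_distrib[symmetric] divide_divide_eq_left)
  also have "\<dots> \<le> (\<Sum>y\<in>J. k * (\<Sum>x\<in>I. \<mu> x * f x y)) / card J"
    by (intro divide_right_mono sum_mono avg_I) auto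
  also have "\<dots> = k * (\<Sum>x\<in>I. \<mu> x * ((\<Sum>y\<in>J. f x y) / card J))"
    by (simp add: sum_distrib_left sum_divide_distrib sum.swap[of _ J] mult_ac)
  also have "\<dots> \<le> k * (\<Sum>x\<in>I. \<mu> x * (k' * (\<Sum>y\<in>J. \<nu> y * f x y)))"
    using assms(1,2) avg_J by (intro mult_left_mono sum_mono) auto
  also have "\<dots> = k * k' * (\<Sum>x\<in>I. \<Sum>y\<in>J. \<mu> x * \<nu> y * f x y)"
    by (simp add: sum_distrib_left mult_ac)
  finally show ?thesis .
qed

section \<open>Characters and the dual group\<close>

lemma cnj_mult_self_eq_1: "cmod z = 1 \<Longrightarrow> cnj z * z = 1"
  by (metis complex_norm_square mult.commute of_real_1 power_one)

lemma character_mult: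
  "\<chi> \<in> characters A \<Longrightarrow> x \<in> carrier A \<Longrightarrow> y \<in> carrier A \<Longrightarrow> \<chi> (x \<otimes>\<^bsub>A\<^esub> y) = \<chi> x * \<chi> y"
  unfolding characters_def by blast

lemma norm_character: "\<chi> \<in> characters A \<Longrightarrow> x \<in> carrier A \<Longrightarrow> cmod (\<chi> x) = 1"
  unfolding characters_def by auto

lemma carrier_dual_group [simp]: "carrier (dual_group A) = characters A"
  by (simp add: dual_group_def)

lemma mult_dual_group: "\<chi> \<otimes>\<^bsub>dual_group A\<^esub> \<psi> = (\<lambda>a\<in>carrier A. \<chi> a * \<psi> a)"
  by (simp add: dual_group_def)

lemma one_dual_group: "\<one>\<^bsub>dual_group A\<^esub> = (\<lambda>a\<in>carrier A. 1)"
  by (simp add: dual_group_def)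

lemma group_dual_group:
  assumes "monoid A"
  shows "group (dual_group A)"
proof (rule groupI)
  show "\<chi> \<otimes>\<^bsub>dual_group A\<^esub> \<psi> \<in> carrier (dual_group A)"
    if "\<chi> \<in> carrier (dual_group A)" "\<psi> \<in> carrier (dual_group A)" for \<chi> \<psi>
    using that monoid.m_closed[OF assms]
    by (auto simp: characters_def mult_dual_group norm_mult mult_ac PiE_iff)
  show "\<one>\<^bsub>dual_group A\<^esub> \<in> carrier (dual_group A)"
    using monoid.m_closed[OF assms] by (auto simp: characters_def one_dual_group)
  show "\<chi> \<otimes>\<^bsub>dual_group A\<^esub> \<psi> \<otimes>\<^bsub>dual_group A\<^esub> \<phi>
      = \<chi> \<otimes>\<^bsub>dual_group A\<^esub> (\<psi> \<otimes>\<^bsub>dual_group A\<^esub> \<phi>)"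
    for \<chi> \<psi> \<phi> by (auto simp: mult_dual_group fun_eq_iff mult_ac)
  show "\<one>\<^bsub>dual_group A\<^esub> \<otimes>\<^bsub>dual_group A\<^esub> \<chi> = \<chi>" if "\<chi> \<in> carrier (dual_group A)" for \<chi>
    using that by (auto simp: characters_def mult_dual_group one_dual_group fun_eq_iff)
  show "\<exists>\<psi>\<in>carrier (dual_group A). \<psi> \<otimes>\<^bsub>dual_group A\<^esub> \<chi> = \<one>\<^bsub>dual_group A\<^esub>"
    if "\<chi> \<in> carrier (dual_group A)" for \<chi>
  proof
    show "(\<lambda>a\<in>carrier A. cnj (\<chi> a)) \<in> carrier (dual_group A)"
      using that monoid.m_closed[OF assms] by (auto simp: characters_def)
    show "(\<lambda>a\<in>carrier A. cnj (\<chi> a)) \<otimes>\<^bsub>dual_group A\<^esub> \<chi> = \<one>\<^bsub>dual_group A\<^esub>"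
      using that
      by (auto simp: mult_dual_group one_dual_group fun_eq_iff norm_character cnj_mult_self_eq_1)
  qed
qed

section \<open>Unitary representations on C^n\<close>

lemma cinner_self: "cinner n \<xi> \<xi> = of_real (vnorm2 n \<xi>)"
  by (simp add: cinner_def vnorm2_def mult.commute flip: complex_norm_square of_real_power)

lemma cinner_commute: "cinner n \<eta> \<xi> = cnj (cinner n \<xi> \<eta>)"
  by (simp add: cinner_def mult.commute)

lemma cinner_diff_right: "cinner n \<zeta> (\<xi> - \<eta>) = cinner n \<zeta> \<xi> - cinner n \<zeta> \<eta>"
  by (simp add: cinner_def right_diff_distrib sum_subtractf)

lemma cinner_lincomb_right:
  "cinner n \<zeta> (\<lambda>i. \<Sum>h\<in>F. c h * f h i) = (\<Sum>h\<in>F. c h * cinner n \<zeta> (f h))"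
  unfolding cinner_def by (simp add: sum_distrib_left sum.swap[of _ F] mult_ac)

lemma vnorm2_diff: "vnorm2 n (\<xi> - \<eta>) = vnorm2 n \<xi> + vnorm2 n \<eta> - 2 * Re (cinner n \<xi> \<eta>)"
  by (simp add: vnorm2_def cinner_def cmod_power2 power2_diff sum.distrib sum_subtractf
      sum_distrib_left algebra_simps)

lemma vnorm2_eq_zeroD:
  assumes "\<xi> \<in> vsp n" and "vnorm2 n \<xi> = 0"
  shows "\<xi> = (\<lambda>i. 0)"
proof
  fix i
  have "\<forall>j\<in>{..<n}. (cmod (\<xi> j))\<^sup>2 = 0"
    using assms(2) unfolding vnorm2_def by (subst sum_nonneg_eq_0_iff[symmetric]) auto
  with assms(1) show "\<xi> i = 0" by (cases "i < n") (auto simp: vsp_def)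
qed

locale finite_unitary_rep =
  fixes G :: "('g, 'b) monoid_scheme" and n :: nat
    and \<rho> :: "'g \<Rightarrow> (nat \<Rightarrow> complex) \<Rightarrow> nat \<Rightarrow> complex"
  assumes group: "group G" and finite_carrier: "finite (carrier G)"
    and unitary_rep: "unitary_rep G n \<rho>"
begin

lemma rep_vsp: "g \<in> carrier G \<Longrightarrow> \<xi> \<in> vsp n \<Longrightarrow> \<rho> g \<xi> \<in> vsp n"
  using unitary_rep unfolding unitary_rep_def bij_betw_def by blast

lemma rep_linear: "g \<in> carrier G \<Longrightarrow> \<xi> \<in> vsp n \<Longrightarrow> \<eta> \<in> vsp n \<Longrightarrow>
    \<rho> g (\<lambda>i. c * \<xi> i + d * \<eta> i) = (\<lambda>i. c * \<rho> g \<xi> i + d * \<rho> g \<eta> i)"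
  using unitary_rep unfolding unitary_rep_def by blast

lemma rep_cinner: "g \<in> carrier G \<Longrightarrow> \<xi> \<in> vsp n \<Longrightarrow> \<eta> \<in> vsp n \<Longrightarrow>
    cinner n (\<rho> g \<xi>) (\<rho> g \<eta>) = cinner n \<xi> \<eta>"
  using unitary_rep unfolding unitary_rep_def by blast

lemma vnorm2_rep: "g \<in> carrier G \<Longrightarrow> \<xi> \<in> vsp n \<Longrightarrow> vnorm2 n (\<rho> g \<xi>) = vnorm2 n \<xi>"
  using rep_cinner[of g \<xi> \<xi>] by (simp add: cinner_self)

lemma rep_mult: "g \<in> carrier G \<Longrightarrow> h \<in> carrier G \<Longrightarrow> \<xi> \<in> vsp n \<Longrightarrow>
    \<rho> (g \<otimes>\<^bsub>G\<^esub> h) \<xi> = \<rho> g (\<rho> h \<xi>)"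
  using unitary_rep unfolding unitary_rep_def by blast

lemma rep_diff: "g \<in> carrier G \<Longrightarrow> \<xi> \<in> vsp n \<Longrightarrow> \<eta> \<in> vsp n \<Longrightarrow>
    \<rho> g (\<xi> - \<eta>) = \<rho> g \<xi> - \<rho> g \<eta>"
  using rep_linear[of g \<xi> \<eta> 1 "-1"] by (simp add: fun_diff_def)

lemma rep_lincomb:
  assumes "finite F" and "g \<in> carrier G" and "\<And>h. h \<in> F \<Longrightarrow> f h \<in> vsp n"
  shows "\<rho> g (\<lambda>i. \<Sum>h\<in>F. c h * f h i) = (\<lambda>i. \<Sum>h\<in>F. c h * \<rho> g (f h) i)"
  using assms
proof (induction F rule: finite_induct)
  case empty
  have "(\<lambda>i. 0) \<in> vsp n" by (simp add: vsp_def)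
  with rep_linear[OF \<open>g \<in> carrier G\<close> this this, of 0 0] show ?case by simp
next
  case (insert h F)
  have "(\<lambda>i. \<Sum>h\<in>F. c h * f h i) \<in> vsp n" using insert.prems by (simp add: vsp_def)
  with insert rep_linear[of g "f h" "\<lambda>i. \<Sum>h\<in>F. c h * f h i" "c h" 1] show ?case by simp
qed

definition rep_average :: "(nat \<Rightarrow> complex) \<Rightarrow> nat \<Rightarrow> complex" where
  "rep_average \<xi> = (\<lambda>i. \<Sum>g\<in>carrier G. 1 / of_nat (card (carrier G)) * \<rho> g \<xi> i)"

lemma card_carrier_pos: "0 < card (carrier G)"
  using finite_carrier group.is_monoid[OF group] monoid.one_closed card_gt_0_iff by blast

lemma rep_average_invariant:
  assumes "\<xi> \<in> vsp n"
  shows "rep_average \<xi> \<in> invariants G n \<rho>"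
proof -
  interpret group G by (fact group)
  have "\<rho> h (rep_average \<xi>) = rep_average \<xi>" if "h \<in> carrier G" for h
  proof -
    have "\<rho> h (rep_average \<xi>)
        = (\<lambda>i. \<Sum>g\<in>carrier G. 1 / of_nat (card (carrier G)) * \<rho> h (\<rho> g \<xi>) i)"
      unfolding rep_average_def using that assms finite_carrier by (intro rep_lincomb rep_vsp)
    also have "\<dots>
        = (\<lambda>i. \<Sum>g\<in>carrier G. 1 / of_nat (card (carrier G)) * \<rho> (h \<otimes>\<^bsub>G\<^esub> g) \<xi> i)"
      using that assms by (simp add: rep_mult)
    also have "\<dots> = rep_average \<xi>"
      unfolding rep_average_def using that
      by (intro ext sum.reindex_bij_witness[of _ "\<lambda>g. inv\<^bsub>G\<^esub> h \<otimes>\<^bsub>G\<^esub> g" "\<lambda>g. h \<otimes>\<^bsub>G\<^esub> g"])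
        (auto simp: m_assoc[symmetric])
    finally show ?thesis .
  qed
  moreover have "rep_average \<xi> \<in> vsp n"
    using assms rep_vsp by (simp add: rep_average_def vsp_def)
  ultimately show ?thesis by (simp add: invariants_def)
qed

lemma cinner_invariant_rep_average:
  assumes "\<zeta> \<in> invariants G n \<rho>" and "\<xi> \<in> vsp n"
  shows "cinner n \<zeta> (rep_average \<xi>) = cinner n \<zeta> \<xi>"
proof -
  have "cinner n \<zeta> (\<rho> g \<xi>) = cinner n \<zeta> \<xi>" if "g \<in> carrier G" for g
    using assms rep_cinner[OF that, of \<zeta> \<xi>] that by (simp add: invariants_def)
  then show ?thesis
    using card_carrier_pos unfolding rep_average_def cinner_lincomb_right by simp
qed

lemma inv_proj_eq_rep_average:
  assumes "\<xi> \<in> vsp n"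
  shows "inv_proj G n \<rho> \<xi> = rep_average \<xi>"
  unfolding inv_proj_def
proof (rule the_equality)
  have "cinner n \<zeta> (\<xi> - rep_average \<xi>) = 0" if "\<zeta> \<in> invariants G n \<rho>" for \<zeta>
    using cinner_invariant_rep_average[OF that assms] by (simp add: cinner_diff_right)
  then show "rep_average \<xi> \<in> invariants G n \<rho> \<and>
      (\<forall>\<zeta>\<in>invariants G n \<rho>. cinner n \<zeta> (\<xi> - rep_average \<xi>) = 0)"
    using rep_average_invariant[OF assms] by blast
next
  fix \<eta>
  assume \<eta>: "\<eta> \<in> invariants G n \<rho> \<and> (\<forall>\<zeta>\<in>invariants G n \<rho>. cinner n \<zeta> (\<xi> - \<eta>) = 0)"
  define \<delta> where "\<delta> = \<eta> - rep_average \<xi>"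
  have \<delta>: "\<delta> \<in> invariants G n \<rho>"
    using \<eta> rep_average_invariant[OF assms]
    unfolding \<delta>_def invariants_def by (auto simp: rep_diff vsp_def)
  have "cinner n \<delta> \<delta> = cinner n \<delta> (\<xi> - rep_average \<xi>) - cinner n \<delta> (\<xi> - \<eta>)"
    by (simp add: \<delta>_def cinner_diff_right)
  also have "\<dots> = 0"
    using \<eta> \<delta> cinner_invariant_rep_average[OF \<delta> assms] by (simp add: cinner_diff_right)
  finally have "\<delta> = (\<lambda>i. 0)"
    using \<delta> by (intro vnorm2_eq_zeroD) (auto simp: cinner_self invariants_def)
  then show "\<eta> = rep_average \<xi>" by (simp add: \<delta>_def fun_diff_def fun_eq_iff)
qed

lemma sum_vnorm2_rep_diff:
  assumes "\<xi> \<in> vsp n"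
  shows "(\<Sum>g\<in>carrier G. vnorm2 n (\<rho> g \<xi> - \<xi>))
           = 2 * card (carrier G) * vnorm2 n (\<xi> - inv_proj G n \<rho> \<xi>)"
proof -
  define P where "P = rep_average \<xi>"
  define N where "N = real (card (carrier G))"
  have P_inv: "P \<in> invariants G n \<rho>"
    unfolding P_def by (rule rep_average_invariant[OF assms])
  have "(\<Sum>g\<in>carrier G. vnorm2 n (\<rho> g \<xi> - \<xi>))
      = (\<Sum>g\<in>carrier G. 2 * vnorm2 n \<xi> - 2 * Re (cinner n \<xi> (\<rho> g \<xi>)))"
    using vnorm2_rep assms cinner_commute[of n \<xi>] by (intro sum.cong) (auto simp: vnorm2_diff)
  also have "\<dots> = 2 * N * vnorm2 n \<xi> - 2 * Re (\<Sum>g\<in>carrier G. cinner n \<xi> (\<rho> g \<xi>))"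
    by (simp add: N_def sum_subtractf Re_sum sum_distrib_left)
  also have "(\<Sum>g\<in>carrier G. cinner n \<xi> (\<rho> g \<xi>)) = of_real N * cinner n \<xi> P"
    using card_carrier_pos unfolding P_def N_def rep_average_def cinner_lincomb_right
    by (simp add: sum_distrib_left)
  finally have "(\<Sum>g\<in>carrier G. vnorm2 n (\<rho> g \<xi> - \<xi>))
      = 2 * N * (vnorm2 n \<xi> - Re (cinner n \<xi> P))"
    by (simp add: right_diff_distrib fun_diff_def)
  moreover have "vnorm2 n P = Re (cinner n \<xi> P)"
    using cinner_invariant_rep_average[OF P_inv assms] cinner_commute[of n \<xi> P]
      cinner_self[of n P]
    by (simp add: P_def)
  then have "vnorm2 n (\<xi> - P) = vnorm2 n \<xi> - Re (cinner n \<xi> P)"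
    by (simp add: vnorm2_diff)
  ultimately show ?thesis
    using inv_proj_eq_rep_average[OF assms] by (simp add: N_def P_def)
qed

lemma average_displacement_le:
  assumes "kappa_const G \<mu> k" and "\<xi> \<in> vsp n"
  shows "(\<Sum>g\<in>carrier G. vnorm2 n (\<rho> g \<xi> - \<xi>)) / card (carrier G)
           \<le> k * (\<Sum>g\<in>carrier G. \<mu> g * vnorm2 n (\<rho> g \<xi> - \<xi>))"
proof -
  have "vnorm2 n (\<xi> - inv_proj G n \<rho> \<xi>)
      \<le> k / 2 * (\<Sum>g\<in>carrier G. \<mu> g * vnorm2 n (\<rho> g \<xi> - \<xi>))"
    using assms unitary_rep unfolding kappa_const_def by blast
  then show ?thesis
    using card_carrier_pos by (simp add: sum_vnorm2_rep_diff[OF assms(2)])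
qed

end

section \<open>Unitary actions on complex inner product spaces\<close>

lemma (in vector_space) span_insert_scale:
  assumes "c \<noteq> 0"
  shows "span (insert (c *s w) T) = span (insert w T)"
proof -
  have "x - k *s w = x - (k / c) *s (c *s w)" for x k
    using assms by simp
  then show ?thesis
    unfolding span_insert by (metis scale_scale)
qed

locale complex_inner_space = vector_space scale
  for scale :: "complex \<Rightarrow> 'v::ab_group_add \<Rightarrow> 'v" (infixr \<open>*s\<close> 75) +
  fixes inner :: "'v \<Rightarrow> 'v \<Rightarrow> complex"
  assumes inner_add_right: "inner x (y + z) = inner x y + inner x z"
    and inner_scale_right: "inner x (c *s y) = c * inner x y"
    and inner_commute: "inner y x = cnj (inner x y)"
    and inner_self_nonneg: "0 \<le> Re (inner x x)"
    and inner_self_eq_zeroD: "inner x x = 0 \<Longrightarrow> x = 0"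
begin

definition norm2 :: "'v \<Rightarrow> real" where
  "norm2 x = Re (inner x x)"

lemma inner_zero_right [simp]: "inner x 0 = 0"
  using inner_add_right[of x 0 0] by simp

lemma inner_diff_right: "inner x (y - z) = inner x y - inner x z"
  using inner_add_right[of x "y - z" z] by simp

lemma inner_sum_right: "inner x (\<Sum>i\<in>I. f i) = (\<Sum>i\<in>I. inner x (f i))"
  by (induction I rule: infinite_finite_induct) (simp_all add: inner_add_right)

lemma inner_scale_left: "inner (c *s x) y = cnj c * inner x y"
  by (subst (1 2) inner_commute) (simp add: inner_scale_right)

lemma inner_sum_left: "inner (\<Sum>i\<in>I. f i) y = (\<Sum>i\<in>I. inner (f i) y)"
  by (subst (1 2) inner_commute) (simp add: inner_sum_right)

lemma inner_self: "inner x x = of_real (norm2 x)"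
proof -
  have "Im (inner x x) = 0"
    using arg_cong[OF inner_commute[of x x], of Im] by simp
  then show ?thesis by (simp add: norm2_def complex_eq_iff)
qed

lemma norm2_nonneg: "0 \<le> norm2 x"
  by (simp add: norm2_def inner_self_nonneg)

lemma norm2_pos: "x \<noteq> 0 \<Longrightarrow> 0 < norm2 x"
  using inner_self_eq_zeroD[of x] norm2_nonneg[of x] by (auto simp: inner_self less_le)

lemma norm2_scale: "norm2 (c *s x) = (cmod c)\<^sup>2 * norm2 x"
proof -
  have "inner (c *s x) (c *s x) = of_real ((cmod c)\<^sup>2) * inner x x"
    by (simp add: inner_scale_left inner_scale_right mult_ac
        flip: complex_norm_square of_real_power)
  then show ?thesis by (simp add: norm2_def)
qed

definition orthonormal :: "(nat \<Rightarrow> 'v) \<Rightarrow> nat \<Rightarrow> bool" where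
  "orthonormal e d \<longleftrightarrow> (\<forall>i<d. \<forall>j<d. inner (e i) (e j) = (if i = j then 1 else 0))"

lemma inner_orthonormal_sum:
  assumes "orthonormal e d" and "l < d"
  shows "inner (e l) (\<Sum>i<d. c i *s e i) = c l"
proof -
  have "inner (e l) (\<Sum>i<d. c i *s e i) = (\<Sum>i<d. c i * inner (e l) (e i))"
    by (simp add: inner_sum_right inner_scale_right)
  also have "\<dots> = (\<Sum>i<d. if i = l then c i else 0)"
    using assms by (intro sum.cong) (auto simp: orthonormal_def)
  finally show ?thesis using assms(2) by simp
qed

lemma orthonormal_expansion:
  assumes "orthonormal e d" and "y \<in> span (e ` {..<d})"
  shows "(\<Sum>i<d. inner (e i) y *s e i) = y"
  using assms(2)
proof (induction rule: span_induct)
  case base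
  have "(\<Sum>i<d. inner (e i) (c *s x) *s e i) = c *s (\<Sum>i<d. inner (e i) x *s e i)" for c x
    by (simp add: inner_scale_right scale_sum_right)
  moreover have "(\<Sum>i<d. inner (e i) (x + y) *s e i)
      = (\<Sum>i<d. inner (e i) x *s e i) + (\<Sum>i<d. inner (e i) y *s e i)" for x y
    by (simp add: inner_add_right scale_left_distrib sum.distrib)
  ultimately show ?case by (auto simp: subspace_def)
next
  case (step y)
  then obtain j where "j < d" and "y = e j" by blast
  then have "(\<Sum>i<d. inner (e i) y *s e i) = (\<Sum>i<d. if i = j then e i else 0)"
    using assms(1) by (intro sum.cong) (auto simp: orthonormal_def)
  with \<open>j < d\<close> \<open>y = e j\<close> show ?case by simp
qed

lemma gram_schmidt:
  assumes "finite S"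
  shows "\<exists>d e. orthonormal e d \<and> span (e ` {..<d}) = span S"
  using assms
proof (induction S rule: finite_induct)
  case empty
  show ?case by (intro exI[of _ 0]) (simp add: orthonormal_def)
next
  case (insert v S)
  then obtain d e where e: "orthonormal e d" and span_e: "span (e ` {..<d}) = span S"
    by blast
  define w where "w = v - (\<Sum>i<d. inner (e i) v *s e i)"
  have w_orth: "inner (e l) w = 0" if "l < d" for l
    using inner_orthonormal_sum[OF e that] by (simp add: w_def inner_diff_right)
  have "span (insert v S) = span (insert v (e ` {..<d}))"
    by (simp only: span_insert span_e)
  also have "\<dots> = span (insert w (e ` {..<d}))"
    by (rule eq_span_insert_eq) (simp add: w_def, intro span_sum span_scale span_base, simp)
  finally have span_w: "span (insert v S) = span (insert w (e ` {..<d}))" .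
  show ?case
  proof (cases "w = 0")
    case True
    with e span_w show ?thesis by auto
  next
    case False
    define r where "r = sqrt (norm2 w)"
    have "0 < r" using norm2_pos[OF False] by (simp add: r_def)
    define e' where "e' = e(d := of_real (1 / r) *s w)"
    have "inner (e' d) (e' d) = 1"
      using \<open>0 < r\<close> norm2_nonneg[of w]
      by (simp add: e'_def inner_self norm2_scale r_def power_divide norm_divide)
    moreover have "inner (e' l) (e' d) = 0" and "inner (e' d) (e' l) = 0" if "l < d" for l
      using w_orth[OF that] that inner_commute[of "e' d" "e' l"]
      by (simp_all add: e'_def inner_scale_right)
    ultimately have "orthonormal e' (Suc d)"
      using e by (auto simp: orthonormal_def less_Suc_eq e'_def)
    moreover have "e' ` {..<Suc d} = insert (of_real (1 / r) *s w) (e ` {..<d})"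
      by (auto simp: lessThan_Suc e'_def)
    then have "span (e' ` {..<Suc d}) = span (insert w (e ` {..<d}))"
      using \<open>0 < r\<close> by (simp add: span_insert_scale)
    ultimately show ?thesis
      using span_w by auto
  qed
qed

definition coords :: "(nat \<Rightarrow> 'v) \<Rightarrow> nat \<Rightarrow> 'v \<Rightarrow> nat \<Rightarrow> complex" where
  "coords e d y = (\<lambda>i. if i < d then inner (e i) y else 0)"

definition lin_comb :: "(nat \<Rightarrow> 'v) \<Rightarrow> nat \<Rightarrow> (nat \<Rightarrow> complex) \<Rightarrow> 'v" where
  "lin_comb e d \<xi> = (\<Sum>i<d. \<xi> i *s e i)"

lemma coords_vsp: "coords e d y \<in> vsp d"
  by (simp add: coords_def vsp_def)

lemma coords_linear:
  "coords e d (c *s y + c' *s z) = (\<lambda>i. c * coords e d y i + c' * coords e d z i)"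
  by (simp add: coords_def inner_add_right inner_scale_right fun_eq_iff)

lemma coords_diff: "coords e d (y - z) = coords e d y - coords e d z"
  by (simp add: coords_def inner_diff_right fun_eq_iff)

lemma lin_comb_linear:
  "lin_comb e d (\<lambda>i. c * \<xi> i + c' * \<eta> i) = c *s lin_comb e d \<xi> + c' *s lin_comb e d \<eta>"
  by (simp add: lin_comb_def scale_left_distrib sum.distrib scale_sum_right)

lemma lin_comb_in_span: "lin_comb e d \<xi> \<in> span (e ` {..<d})"
  unfolding lin_comb_def by (intro span_sum span_scale span_base) simp

lemma coords_lin_comb:
  assumes "orthonormal e d" and "\<xi> \<in> vsp d"
  shows "coords e d (lin_comb e d \<xi>) = \<xi>"
  using assms by (auto simp: coords_def lin_comb_def inner_orthonormal_sum vsp_def)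

lemma lin_comb_coords:
  assumes "orthonormal e d" and "y \<in> span (e ` {..<d})"
  shows "lin_comb e d (coords e d y) = y"
  using orthonormal_expansion[OF assms] by (simp add: lin_comb_def coords_def)

lemma inner_lin_comb:
  assumes "orthonormal e d"
  shows "inner (lin_comb e d \<xi>) (lin_comb e d \<eta>) = cinner d \<xi> \<eta>"
  unfolding lin_comb_def[of e d \<xi>]
  using inner_orthonormal_sum[OF assms]
  by (simp add: inner_sum_left inner_scale_left cinner_def lin_comb_def)

lemma cinner_coords:
  assumes "orthonormal e d" and "y \<in> span (e ` {..<d})" and "z \<in> span (e ` {..<d})"
  shows "cinner d (coords e d y) (coords e d z) = inner y z"
  using inner_lin_comb[OF assms(1), of "coords e d y" "coords e d z"]
  by (simp add: lin_comb_coords assms)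

lemma vnorm2_coords:
  assumes "orthonormal e d" and "y \<in> span (e ` {..<d})"
  shows "vnorm2 d (coords e d y) = norm2 y"
  using cinner_coords[OF assms assms(2)] by (simp add: cinner_self inner_self)

definition unitary_action :: "('g, 'b) monoid_scheme \<Rightarrow> ('g \<Rightarrow> 'v \<Rightarrow> 'v) \<Rightarrow> bool" where
  "unitary_action G \<pi> \<longleftrightarrow>
     (\<forall>g\<in>carrier G. Vector_Spaces.linear (*s) (*s) (\<pi> g) \<and>
        (\<forall>y z. inner (\<pi> g y) (\<pi> g z) = inner y z)) \<and>
     (\<forall>g\<in>carrier G. \<forall>h\<in>carrier G. \<forall>y. \<pi> (g \<otimes>\<^bsub>G\<^esub> h) y = \<pi> g (\<pi> h y)) \<and>
     (\<forall>y. \<pi> \<one>\<^bsub>G\<^esub> y = y)"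

lemma unitary_rep_coords:
  assumes "group G" and action: "unitary_action G \<pi>" and e: "orthonormal e d"
    and invariant: "\<And>g. g \<in> carrier G \<Longrightarrow> \<pi> g ` span (e ` {..<d}) \<subseteq> span (e ` {..<d})"
  shows "unitary_rep G d (\<lambda>g \<xi>. coords e d (\<pi> g (lin_comb e d \<xi>)))"
    (is "unitary_rep G d ?\<rho>")
proof -
  interpret G: group G by fact
  have \<pi>_span: "\<pi> g (lin_comb e d \<xi>) \<in> span (e ` {..<d})" if "g \<in> carrier G" for g \<xi>
    using invariant[OF that] lin_comb_in_span by blast
  have \<rho>_mult: "?\<rho> (g \<otimes>\<^bsub>G\<^esub> h) \<xi> = ?\<rho> g (?\<rho> h \<xi>)"
    if "g \<in> carrier G" "h \<in> carrier G" for g h \<xi>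
    using action that by (simp add: unitary_action_def lin_comb_coords[OF e \<pi>_span])
  have \<rho>_one: "?\<rho> \<one>\<^bsub>G\<^esub> \<xi> = \<xi>" if "\<xi> \<in> vsp d" for \<xi>
    using action that by (simp add: unitary_action_def coords_lin_comb[OF e])
  show ?thesis
    unfolding unitary_rep_def
  proof (intro conjI ballI allI)
    fix g assume g: "g \<in> carrier G"
    interpret \<pi>g: Vector_Spaces.linear "(*s)" "(*s)" "\<pi> g"
      using action g by (simp add: unitary_action_def)
    have "?\<rho> (inv\<^bsub>G\<^esub> g) (?\<rho> g \<xi>) = \<xi>" "?\<rho> g (?\<rho> (inv\<^bsub>G\<^esub> g) \<xi>) = \<xi>"
      if "\<xi> \<in> vsp d" for \<xi>
      using g that by (simp_all flip: \<rho>_mult add: \<rho>_one)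
    then show "bij_betw (?\<rho> g) (vsp d) (vsp d)"
      by (intro bij_betw_byWitness[where f' = "?\<rho> (inv\<^bsub>G\<^esub> g)"]) (auto simp: coords_vsp)
    show "?\<rho> g (\<lambda>i. c * \<xi> i + c' * \<eta> i) = (\<lambda>i. c * ?\<rho> g \<xi> i + c' * ?\<rho> g \<eta> i)"
      for \<xi> \<eta> c c'
      by (simp add: lin_comb_linear \<pi>g.add \<pi>g.scale coords_linear)
    show "cinner d (?\<rho> g \<xi>) (?\<rho> g \<eta>) = cinner d \<xi> \<eta>" for \<xi> \<eta>
      using action g
      by (simp add: cinner_coords[OF e \<pi>_span \<pi>_span] unitary_action_def inner_lin_comb[OF e])
  next
    show "?\<rho> (g \<otimes>\<^bsub>G\<^esub> h) \<xi> = ?\<rho> g (?\<rho> h \<xi>)"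
      if "g \<in> carrier G" "h \<in> carrier G" for g h \<xi>
      using \<rho>_mult that .
  qed
qed

lemma span_orbit_invariant:
  assumes "group G" and action: "unitary_action G \<pi>" and "g \<in> carrier G"
  shows "\<pi> g ` span ((\<lambda>h. \<pi> h x) ` carrier G) \<subseteq> span ((\<lambda>h. \<pi> h x) ` carrier G)"
proof -
  interpret G: group G by fact
  interpret \<pi>g: Vector_Spaces.linear "(*s)" "(*s)" "\<pi> g"
    using action \<open>g \<in> carrier G\<close> by (simp add: unitary_action_def)
  have "\<pi> g (\<pi> h x) = \<pi> (g \<otimes>\<^bsub>G\<^esub> h) x" if "h \<in> carrier G" for h
    using action \<open>g \<in> carrier G\<close> that by (simp add: unitary_action_def)
  then have "\<pi> g ` (\<lambda>h. \<pi> h x) ` carrier G \<subseteq> (\<lambda>h. \<pi> h x) ` carrier G"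
    using \<open>g \<in> carrier G\<close> by auto
  then show ?thesis
    by (simp add: \<pi>g.span_image[symmetric] span_mono)
qed

lemma average_displacement_le:
  assumes "group G" and "finite (carrier G)" and "kappa_const G \<mu> k"
    and action: "unitary_action G \<pi>"
  shows "(\<Sum>g\<in>carrier G. norm2 (\<pi> g x - x)) / card (carrier G)
           \<le> k * (\<Sum>g\<in>carrier G. \<mu> g * norm2 (\<pi> g x - x))"
proof -
  define W where "W = span ((\<lambda>h. \<pi> h x) ` carrier G)"
  obtain d e where e: "orthonormal e d" and span_e: "span (e ` {..<d}) = W"
    using gram_schmidt[of "(\<lambda>h. \<pi> h x) ` carrier G"] \<open>finite (carrier G)\<close>
    unfolding W_def by blast
  have invariant: "\<pi> g ` W \<subseteq> W" if "g \<in> carrier G" for g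
    unfolding W_def using assms(1) action that by (rule span_orbit_invariant)
  define \<rho> where "\<rho> = (\<lambda>g \<xi>. coords e d (\<pi> g (lin_comb e d \<xi>)))"
  interpret finite_unitary_rep G d \<rho>
    using assms(1,2) unitary_rep_coords[OF assms(1) action e] invariant
    by (intro finite_unitary_rep.intro) (simp_all add: \<rho>_def span_e)
  have "x = \<pi> \<one>\<^bsub>G\<^esub> x"
    using action by (simp add: unitary_action_def)
  then have "x \<in> W"
    unfolding W_def using group.is_monoid[OF assms(1)]
    by (metis span_base imageI monoid.one_closed)
  with invariant have displacement_W: "\<pi> g x - x \<in> W" if "g \<in> carrier G" for g
    using that by (blast intro: span_diff[of _ "(\<lambda>h. \<pi> h x) ` carrier G", folded W_def])
  have "\<rho> g (coords e d x) - coords e d x = coords e d (\<pi> g x - x)" for g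
    using \<open>x \<in> W\<close> by (simp add: \<rho>_def coords_diff lin_comb_coords[OF e] span_e)
  then have "vnorm2 d (\<rho> g (coords e d x) - coords e d x) = norm2 (\<pi> g x - x)"
    if "g \<in> carrier G" for g
    using displacement_W[OF that] by (simp add: vnorm2_coords[OF e] span_e)
  then show ?thesis
    using average_displacement_le[OF assms(3) coords_vsp, of e x] by simp
qed

end

section \<open>Tracial *-algebras\<close>

locale tracial_algebra =
  fixes sm :: "complex \<Rightarrow> 'm::ring_1 \<Rightarrow> 'm" and st :: "'m \<Rightarrow> 'm" and tau :: "'m \<Rightarrow> complex"
  assumes tracial_star_algebra: "tracial_star_algebra sm st tau"
begin

lemma
  shows sm_one: "sm 1 x = x"
    and sm_sm: "sm a (sm b x) = sm (a * b) x"
    and sm_add_left: "sm (a + b) x = sm a x + sm b x"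
    and sm_add_right: "sm a (x + y) = sm a x + sm a y"
    and sm_mult_left: "sm a x * y = sm a (x * y)"
    and sm_mult_right: "x * sm a y = sm a (x * y)"
    and st_st: "st (st x) = x"
    and st_add: "st (x + y) = st x + st y"
    and st_sm: "st (sm a x) = sm (cnj a) (st x)"
    and st_mult: "st (x * y) = st y * st x"
    and tau_add: "tau (x + y) = tau x + tau y"
    and tau_sm: "tau (sm a x) = a * tau x"
    and tau_commute: "tau (x * y) = tau (y * x)"
    and tau_self_real: "Im (tau (st x * x)) = 0"
    and tau_self_nonneg: "0 \<le> Re (tau (st x * x))"
    and tau_faithful: "tau (st x * x) = 0 \<Longrightarrow> x = 0"
  using tracial_star_algebra[unfolded tracial_star_algebra_def] by (blast | metis)+

lemma tau_adjoint_commute: "tau (st y * x) = cnj (tau (st x * y))"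
proof -
  \<comment> \<open>Polarization: \<open>tau (st z * z)\<close> is real for \<open>z = x + y\<close> and for \<open>z = x + \<i> y\<close>.\<close>
  have expand: "tau (st (x + sm c y) * (x + sm c y))
      = tau (st x * x) + c * tau (st x * y) + cnj c * tau (st y * x) + cnj c * c * tau (st y * y)"
    for c
    by (simp add: st_add st_sm distrib_left distrib_right sm_mult_left sm_mult_right sm_sm tau_add
        tau_sm mult_ac)
  have "Im (tau (st x * y)) + Im (tau (st y * x)) = 0"
    using tau_self_real[of "x + sm 1 y"] tau_self_real[of x] tau_self_real[of y]
    by (simp add: expand)
  moreover have "Re (tau (st x * y)) - Re (tau (st y * x)) = 0"
    using tau_self_real[of "x + sm \<i> y"] tau_self_real[of x] tau_self_real[of y]
    by (simp add: expand)
  ultimately show ?thesis by (simp add: complex_eq_iff)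
qed

sublocale complex_inner_space sm "\<lambda>x y. tau (st x * y)"
proof unfold_locales
  show "tau (st x * (y + z)) = tau (st x * y) + tau (st x * z)" for x y z
    by (simp add: distrib_left tau_add)
  show "tau (st x * sm c y) = c * tau (st x * y)" for x c y
    by (simp add: sm_mult_right tau_sm)
  show "tau (st y * x) = cnj (tau (st x * y))" for x y
    by (rule tau_adjoint_commute)
qed (simp_all add: sm_one sm_sm sm_add_left sm_add_right tau_self_nonneg tau_faithful)

lemma norm2sq_eq_norm2: "norm2sq st tau x = norm2 x"
  by (simp add: norm2sq_def norm2_def)

lemma st_one: "st 1 = 1"
  using st_mult[of "st 1" 1] by (simp add: st_st)

lemma st_unitary: "u \<in> unitaries st \<Longrightarrow> st u \<in> unitaries st"
  by (simp add: unitaries_def st_st)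

lemma norm2_mult_unitary_left:
  assumes "u \<in> unitaries st"
  shows "norm2 (u * x) = norm2 x"
proof -
  have "st (u * x) * (u * x) = st x * (st u * u) * x"
    by (simp add: st_mult mult.assoc)
  with assms show ?thesis by (simp add: norm2_def unitaries_def)
qed

lemma norm2_mult_unitary_right:
  assumes "u \<in> unitaries st"
  shows "norm2 (x * u) = norm2 x"
proof -
  have "tau (st (x * u) * (x * u)) = tau ((st u * (st x * x)) * u)"
    by (simp add: st_mult mult.assoc)
  also have "\<dots> = tau (u * (st u * (st x * x)))"
    by (rule tau_commute)
  finally show ?thesis
    using assms by (simp add: norm2_def unitaries_def mult.assoc[symmetric])
qed

lemma inner_conj_unitary:
  assumes "u \<in> unitaries st"
  shows "tau (st (u * y * st u) * (u * z * st u)) = tau (st y * z)"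
proof -
  have cancel: "st u * (u * w) = w" for w
    using assms by (simp add: unitaries_def mult.assoc[symmetric])
  have "tau (st (u * y * st u) * (u * z * st u)) = tau (u * (st y * z * st u))"
    by (simp add: st_mult st_st mult.assoc cancel)
  also have "\<dots> = tau (st y * z * st u * u)"
    by (rule tau_commute)
  also have "\<dots> = tau (st y * z)"
    using assms by (simp add: unitaries_def mult.assoc)
  finally show ?thesis .
qed

lemma unitary_hom_one:
  assumes "monoid G" and "W \<in> carrier G \<rightarrow> unitaries st"
    and "\<forall>g\<in>carrier G. \<forall>h\<in>carrier G. W (g \<otimes>\<^bsub>G\<^esub> h) = W g * W h"
  shows "W \<one>\<^bsub>G\<^esub> = 1"
proof -
  define w where "w = W \<one>\<^bsub>G\<^esub>"
  have "st w * w = 1"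
    using assms(2) monoid.one_closed[OF assms(1)] by (auto simp: unitaries_def w_def)
  have "w * w = w"
    using assms(3) monoid.one_closed[OF assms(1)] monoid.l_one[OF assms(1)] by (metis w_def)
  have "w = st w * w * w"
    using \<open>st w * w = 1\<close> by simp
  also have "\<dots> = st w * (w * w)"
    by (simp only: mult.assoc)
  also have "\<dots> = 1"
    using \<open>st w * w = 1\<close> \<open>w * w = w\<close> by simp
  finally show ?thesis by (simp add: w_def)
qed

lemma unitary_action_twisted_conj:
  assumes "group G" and W: "W \<in> carrier G \<rightarrow> unitaries st"
    and W_mult: "\<forall>g\<in>carrier G. \<forall>h\<in>carrier G. W (g \<otimes>\<^bsub>G\<^esub> h) = W g * W h"
    and c_norm: "\<forall>g\<in>carrier G. cmod (c g) = 1"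
    and c_mult: "\<forall>g\<in>carrier G. \<forall>h\<in>carrier G. c (g \<otimes>\<^bsub>G\<^esub> h) = c g * c h"
  shows "unitary_action G (\<lambda>g y. sm (cnj (c g)) (W g * y * st (W g)))"
proof -
  interpret G: group G by fact
  have "c \<one>\<^bsub>G\<^esub> * c \<one>\<^bsub>G\<^esub> = c \<one>\<^bsub>G\<^esub>" and "c \<one>\<^bsub>G\<^esub> \<noteq> 0"
    using c_mult c_norm by (metis G.l_one G.one_closed, force)
  then have c_one: "c \<one>\<^bsub>G\<^esub> = 1" by simp
  have "Vector_Spaces.linear sm sm (\<lambda>y. sm (cnj (c g)) (W g * y * st (W g)))" for g
    by unfold_locales
      (simp_all add: distrib_left distrib_right sm_add_right sm_mult_left sm_mult_right sm_sm
        mult.commute)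
  moreover have
    "tau (st (sm (cnj (c g)) (W g * y * st (W g))) * sm (cnj (c g)) (W g * z * st (W g)))
      = tau (st y * z)" if "g \<in> carrier G" for g y z
  proof -
    have "cnj (c g) * c g = 1" and "W g \<in> unitaries st"
      using c_norm W that by (auto simp: cnj_mult_self_eq_1)
    then show ?thesis
      using inner_conj_unitary[of "W g" y z]
      by (simp add: st_sm sm_mult_left sm_mult_right sm_sm tau_sm)
  qed
  moreover have "sm (cnj (c (g \<otimes>\<^bsub>G\<^esub> h))) (W (g \<otimes>\<^bsub>G\<^esub> h) * y * st (W (g \<otimes>\<^bsub>G\<^esub> h)))
      = sm (cnj (c g)) (W g * sm (cnj (c h)) (W h * y * st (W h)) * st (W g))"
    if "g \<in> carrier G" "h \<in> carrier G" for g h y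
    using W_mult c_mult that by (simp add: st_mult sm_mult_left sm_mult_right sm_sm mult.assoc)
  moreover have "W \<one>\<^bsub>G\<^esub> = 1"
    using G.is_monoid W W_mult by (rule unitary_hom_one)
  ultimately show ?thesis
    by (simp add: unitary_action_def c_one st_one sm_one)
qed

lemma norm2_twisted_conj_diff:
  assumes "u \<in> unitaries st" and "cmod c = 1"
  shows "norm2 (sm (cnj c) (u * y * st u) - y) = norm2 (u * y - sm c (y * u))"
proof -
  have "u * st u = 1"
    using assms(1) by (simp add: unitaries_def)
  then have "(u * y - sm c (y * u)) * st u = u * y * st u - sm c y"
    by (simp add: left_diff_distrib sm_mult_left mult.assoc)
  then have "sm (cnj c) (u * y * st u) - y = sm (cnj c) ((u * y - sm c (y * u)) * st u)"
    using assms(2) by (simp add: scale_right_diff_distrib sm_sm cnj_mult_self_eq_1 sm_one)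
  then have "norm2 (sm (cnj c) (u * y * st u) - y) = norm2 ((u * y - sm c (y * u)) * st u)"
    using assms(2) by (simp add: norm2_scale)
  also have "\<dots> = norm2 (u * y - sm c (y * u))"
    using assms(1) by (intro norm2_mult_unitary_right st_unitary)
  finally show ?thesis .
qed

lemma average_twisted_commutator_le:
  assumes "group G" and "finite (carrier G)" and "kappa_const G \<mu> k"
    and W: "W \<in> carrier G \<rightarrow> unitaries st"
    and "\<forall>g\<in>carrier G. \<forall>h\<in>carrier G. W (g \<otimes>\<^bsub>G\<^esub> h) = W g * W h"
    and c_norm: "\<forall>g\<in>carrier G. cmod (c g) = 1"
    and "\<forall>g\<in>carrier G. \<forall>h\<in>carrier G. c (g \<otimes>\<^bsub>G\<^esub> h) = c g * c h"
  shows "(\<Sum>g\<in>carrier G. norm2sq st tau (W g * y - sm (c g) (y * W g))) / card (carrier G)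
           \<le> k * (\<Sum>g\<in>carrier G. \<mu> g * norm2sq st tau (W g * y - sm (c g) (y * W g)))"
  using average_displacement_le[OF assms(1-3) unitary_action_twisted_conj[OF assms(1,4-7)], of y]
    norm2_twisted_conj_diff W c_norm
  by (simp add: norm2sq_eq_norm2 Pi_iff)

lemma norm2_adjoint_commutator:
  assumes "w \<in> unitaries st"
  shows "norm2 (st w * y - sm c (y * st w)) = norm2 (y * w - sm c (w * y))"
proof -
  have "st w * w = 1" and "st w * (w * x) = x" and "w * (st w * x) = x" for x
    using assms by (simp_all add: unitaries_def flip: mult.assoc)
  then have "w * (st w * y - sm c (y * st w)) * w = y * w - sm c (w * y)"
    by (simp add: right_diff_distrib left_diff_distrib sm_mult_left sm_mult_right mult.assoc)
  then show ?thesis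
    using assms by (metis norm2_mult_unitary_left norm2_mult_unitary_right)
qed

lemma average_dual_commutator_le:
  assumes "monoid A" and "finite (characters A)" and "kappa_const (dual_group A) \<nu> k"
    and V: "V \<in> characters A \<rightarrow> unitaries st"
    and V_mult: "\<forall>\<chi>\<in>characters A. \<forall>\<psi>\<in>characters A.
      V (\<chi> \<otimes>\<^bsub>dual_group A\<^esub> \<psi>) = V \<chi> * V \<psi>"
    and "a \<in> carrier A"
  shows "(\<Sum>\<chi>\<in>characters A. norm2sq st tau (u * V \<chi> - sm (\<chi> a) (V \<chi> * u)))
           / card (characters A)
         \<le> k * (\<Sum>\<chi>\<in>characters A. \<nu> \<chi> * norm2sq st tau (u * V \<chi> - sm (\<chi> a) (V \<chi> * u)))"
proof -
  have "st (V (\<chi> \<otimes>\<^bsub>dual_group A\<^esub> \<psi>)) = st (V \<chi>) * st (V \<psi>)"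
    if "\<chi> \<in> characters A" "\<psi> \<in> characters A" for \<chi> \<psi>
  proof -
    have "\<psi> \<otimes>\<^bsub>dual_group A\<^esub> \<chi> = \<chi> \<otimes>\<^bsub>dual_group A\<^esub> \<psi>"
      by (simp add: mult_dual_group mult.commute)
    then show ?thesis
      using V_mult that by (metis st_mult)
  qed
  moreover have "(\<chi> \<otimes>\<^bsub>dual_group A\<^esub> \<psi>) a = \<chi> a * \<psi> a" for \<chi> \<psi>
    using \<open>a \<in> carrier A\<close> by (simp add: mult_dual_group)
  ultimately have "(\<Sum>\<chi>\<in>characters A. norm2sq st tau (st (V \<chi>) * u - sm (\<chi> a) (u * st (V \<chi>))))
        / card (characters A)
      \<le> k * (\<Sum>\<chi>\<in>characters A. \<nu> \<chi> * norm2sq st tau (st (V \<chi>) * u - sm (\<chi> a) (u * st (V \<chi>))))"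
    using average_twisted_commutator_le[of "dual_group A" \<nu> k "\<lambda>\<chi>. st (V \<chi>)" "\<lambda>\<chi>. \<chi> a" u]
      group_dual_group[OF assms(1)] assms(2,3) V \<open>a \<in> carrier A\<close>
    by (simp add: Pi_iff st_unitary norm_character)
  moreover have
    "norm2 (st (V \<chi>) * u - sm (\<chi> a) (u * st (V \<chi>))) = norm2 (u * V \<chi> - sm (\<chi> a) (V \<chi> * u))"
    if "\<chi> \<in> characters A" for \<chi>
    using V that by (intro norm2_adjoint_commutator) auto
  ultimately show ?thesis
    by (simp add: norm2sq_eq_norm2)
qed

end

theorem corollary2p5:
  fixes A :: "('a, 'b) monoid_scheme"
    and \<mu> :: "'a \<Rightarrow> real" and \<nu> :: "('a \<Rightarrow> complex) \<Rightarrow> real"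
    and sm :: "complex \<Rightarrow> 'm::ring_1 \<Rightarrow> 'm" and st :: "'m \<Rightarrow> 'm" and tau :: "'m \<Rightarrow> complex"
    and U :: "'a \<Rightarrow> 'm" and V :: "('a \<Rightarrow> complex) \<Rightarrow> 'm" and \<epsilon> :: real
  assumes "comm_group A" and "finite (carrier A)"
    and "prob_on (carrier A) \<mu>" and "prob_on (characters A) \<nu>"
    and "tracial_star_algebra sm st tau"
    and "U \<in> carrier A \<rightarrow> unitaries st"
    and "\<forall>a\<in>carrier A. \<forall>b\<in>carrier A. U (a \<otimes>\<^bsub>A\<^esub> b) = U a * U b"
    and "V \<in> characters A \<rightarrow> unitaries st"
    and "\<forall>\<chi>\<in>characters A. \<forall>\<psi>\<in>characters A.
           V (\<chi> \<otimes>\<^bsub>dual_group A\<^esub> \<psi>) = V \<chi> * V \<psi>"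
    and "(\<Sum>a\<in>carrier A. \<Sum>\<chi>\<in>characters A.
           \<mu> a * \<nu> \<chi> * norm2sq st tau (U a * V \<chi> - sm (\<chi> a) (V \<chi> * U a))) \<le> \<epsilon>"
  shows "kappa A \<mu> = \<infinity> \<or> kappa (dual_group A) \<nu> = \<infinity> \<or>
         (\<Sum>a\<in>carrier A. \<Sum>\<chi>\<in>characters A.
             norm2sq st tau (U a * V \<chi> - sm (\<chi> a) (V \<chi> * U a)))
           / real (card (carrier A) * card (characters A))
         \<le> real_of_ereal (kappa A \<mu>) * real_of_ereal (kappa (dual_group A) \<nu>) * \<epsilon>"
proof (cases "kappa A \<mu> = \<infinity> \<or> kappa (dual_group A) \<nu> = \<infinity>")
  case False
  interpret A: comm_group A by fact
  interpret tracial_algebra sm st tau by (rule tracial_algebra.intro) fact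
  define f where "f a \<chi> = norm2sq st tau (U a * V \<chi> - sm (\<chi> a) (V \<chi> * U a))" for a \<chi>
  define k\<mu> where "k\<mu> = real_of_ereal (kappa A \<mu>)"
  define k\<nu> where "k\<nu> = real_of_ereal (kappa (dual_group A) \<nu>)"
  have "\<forall>a\<in>carrier A. 0 \<le> \<mu> a" and "\<forall>\<chi>\<in>characters A. 0 \<le> \<nu> \<chi>" and "finite (characters A)"
    using assms(3,4) by (auto simp: prob_on_def intro: sum.infinite[THEN contrapos_pp])
  then have "kappa_const A \<mu> k\<mu>" "0 \<le> k\<mu>" "kappa_const (dual_group A) \<nu> k\<nu>" "0 \<le> k\<nu>"
    using kappa_finite_admissible[of A \<mu>] kappa_finite_admissible[of "dual_group A" \<nu>] False
    by (simp_all add: k\<mu>_def k\<nu>_def)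
  have "(\<Sum>a\<in>carrier A. \<Sum>\<chi>\<in>characters A. f a \<chi>) / real (card (carrier A) * card (characters A))
      \<le> k\<mu> * k\<nu> * (\<Sum>a\<in>carrier A. \<Sum>\<chi>\<in>characters A. \<mu> a * \<nu> \<chi> * f a \<chi>)"
  proof (rule double_average_le)
    show "(\<Sum>a\<in>carrier A. f a \<chi>) / card (carrier A) \<le> k\<mu> * (\<Sum>a\<in>carrier A. \<mu> a * f a \<chi>)"
      if "\<chi> \<in> characters A" for \<chi>
      unfolding f_def using that assms(2,6,7) \<open>kappa_const A \<mu> k\<mu>\<close>
      by (intro average_twisted_commutator_le) (auto simp: norm_character character_mult)
    show "(\<Sum>\<chi>\<in>characters A. f a \<chi>) / card (characters A)
        \<le> k\<nu> * (\<Sum>\<chi>\<in>characters A. \<nu> \<chi> * f a \<chi>)" if "a \<in> carrier A" for a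
      unfolding f_def
      using that assms(8,9) \<open>finite (characters A)\<close> \<open>kappa_const (dual_group A) \<nu> k\<nu>\<close>
      by (intro average_dual_commutator_le) auto
  qed fact+
  also have "\<dots> \<le> k\<mu> * k\<nu> * \<epsilon>"
    using assms(10) \<open>0 \<le> k\<mu>\<close> \<open>0 \<le> k\<nu>\<close> by (intro mult_left_mono) (auto simp: f_def)
  finally show ?thesis by (simp add: f_def k\<mu>_def k\<nu>_def)
qed blast

end
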